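(* For all integers $n\geq 0$ and $k>0$, $$(-1)^{k} \left( b_6(n) - \sum_{j=-(k-1)}^{k} (-1)^j\, p\big(n-3j(3j-1)\big) \right) = \sum_{j=0}^{\lfloor n/6 \rfloor} b_6(n-6j)\, M_k(j).$$
   Context: $p(n)$ denotes the number of partitions of $n$, with $p(0)=1$ and $p(n)=0$ for $n<0$. A partition is called $6$-regular if none of its parts is divisible by $6$; $b_6(n)$ denotes the number of $6$-regular partitions of $n$ (with $b_6(0)=1$). $M_k(n)$ denotes the number of partitions of $n$ in which $k$ is the least positive integer that is not a part and there are more parts $>k$ than there are parts $<k$ (parts counted with multiplicity). *)

theory Defs
  imports Main "HOL-Library.Multiset"
begin

definition partitions :: "nat \<Rightarrow> nat multiset set" where
  "partitions n = {\<mu>. 0 \<notin># \<mu> \<and> \<Sum>\<^sub># \<mu> = n}"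

definition p :: "int \<Rightarrow> nat" where
  "p n = (if n < 0 then 0 else card (partitions (nat n)))"

definition regular :: "nat \<Rightarrow> nat multiset \<Rightarrow> bool" where
  "regular l \<mu> \<longleftrightarrow> (\<forall>i\<in>#\<mu>. \<not> l dvd i)"

definition b :: "nat \<Rightarrow> nat \<Rightarrow> nat" where
  "b l n = card {\<mu> \<in> partitions n. regular l \<mu>}"

definition M :: "nat \<Rightarrow> nat \<Rightarrow> nat" where
  "M k n = card {\<mu> \<in> partitions n.
     k = (LEAST i. 0 < i \<and> i \<notin># \<mu>) \<and>
     size {#i \<in># \<mu>. i > k#} > size {#i \<in># \<mu>. i < k#}}"

text \<open>The sets counted above are finite, so \<^const>\<open>card\<close> really counts them.\<close>

lemma finite_partitions: "finite (partitions n)"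
proof -
  have bound: "length xs \<le> sum_list xs \<and> set xs \<subseteq> {..sum_list xs}" if "0 \<notin> set xs" for xs :: "nat list"
    using that by (induction xs) (auto intro: le_trans)
  have "partitions n \<subseteq> mset ` {xs. set xs \<subseteq> {..n} \<and> length xs \<le> n}"
  proof
    fix \<mu> assume \<mu>: "\<mu> \<in> partitions n"
    obtain xs where xs: "mset xs = \<mu>" using ex_mset by blast
    then have "0 \<notin> set xs" "sum_list xs = n"
      using \<mu> by (auto simp: partitions_def sum_mset_sum_list)
    with bound xs show "\<mu> \<in> mset ` {xs. set xs \<subseteq> {..n} \<and> length xs \<le> n}" by blast
  qed
  then show ?thesis
    by (rule finite_subset) (simp add: finite_lists_length_le)
qed

lemma p_0: "p 0 = 1"
proof -
  have "partitions 0 = {{#}}"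
    by (auto simp: partitions_def) (metis multiset_nonemptyE)
  then show ?thesis by (simp add: p_def)
qed

end

theory Submission
  imports Defs "HOL-Computational_Algebra.Formal_Power_Series"
begin

text \<open>
  Write \<open>P\<close>, \<open>B\<close> and \<open>M\<^sub>k\<close> for the generating functions of \<open>p\<close>, \<open>b\<^sub>6\<close> and \<open>M\<^sub>k\<close>.
  Splitting a partition into its parts below and above \<open>k\<close>, and fixing the number \<open>m\<close> of parts
  above, gives \<open>M\<^sub>k = \<Sum>\<^sub>m q\<^bsup>k(k-1)/2 + (k+1)m\<^esup> / (q)\<^sub>m \<cdot> [m-1, k-1]\<^sub>q\<close>.
  Over the common denominator \<open>(q)\<^sub>k (1 - q\<^sup>m) (q)\<^bsub>m-k\<^esub>\<close> the \<open>m\<close>-th terms of \<open>M\<^sub>k\<close> and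
  \<open>M\<^bsub>k+1\<^esub>\<close> add up to a multiple of
  \<open>(1 - q\<^sup>k) + q\<^bsup>m+k\<^esup> (1 - q\<^bsup>m-k\<^esup>) = (1 - q\<^sup>m) (1 + q\<^sup>m - q\<^sup>k)\<close>. The factor \<open>1 - q\<^sup>m\<close> cancels, and
  what remains counts partitions into \<open>m - k\<close> parts bounded below, so that
  \<open>M\<^sub>k + M\<^bsub>k+1\<^esub> = q\<^bsup>k(3k+1)/2\<^esup> (1 - q\<^bsup>2k+1\<^esup>) P\<close>. By induction on \<open>k\<close> this yields the truncated
  pentagonal number theorem of Andrews and Merca. Substituting \<open>q\<^sup>6\<close> for \<open>q\<close> and multiplying by
  \<open>B\<close> proves the claim, because \<open>B(q) P(q\<^sup>6) = P(q)\<close>.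
\<close>

unbundle fps_syntax

section \<open>Generating functions of sets of partitions\<close>

text \<open>Intersecting with \<open>partitions n\<close> discards multisets containing 0 and leaves
  a finite set, so \<open>S\<close> may be described without regard to positivity.\<close>

definition part_gf :: "nat multiset set \<Rightarrow> int fps" where
  "part_gf S = Abs_fps (\<lambda>n. int (card (S \<inter> partitions n)))"

lemma part_gf_nth: "part_gf S $ n = int (card (S \<inter> partitions n))"
  by (simp add: part_gf_def)

lemma part_gf_cong:
  assumes "\<And>\<mu>. 0 \<notin># \<mu> \<Longrightarrow> \<mu> \<in> S \<longleftrightarrow> \<mu> \<in> T"
  shows "part_gf S = part_gf T"
proof -
  have "S \<inter> partitions n = T \<inter> partitions n" for n
    using assms by (auto simp: partitions_def)
  then show ?thesis by (simp add: part_gf_def)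
qed

lemma part_gf_empty [simp]: "part_gf {} = 0"
  by (simp add: fps_eq_iff part_gf_nth)

lemma part_gf_single_empty [simp]: "part_gf {{#}} = 1"
proof -
  have "{{#}} \<inter> partitions n = (if n = 0 then {{#}} else {})" for n
    by (auto simp: partitions_def)
  then show ?thesis by (simp add: fps_eq_iff part_gf_nth)
qed

lemma part_gf_Un:
  assumes "\<And>\<mu>. 0 \<notin># \<mu> \<Longrightarrow> \<mu> \<in> S \<Longrightarrow> \<mu> \<in> T \<Longrightarrow> False"
  shows "part_gf (S \<union> T) = part_gf S + part_gf T"
proof -
  have "card ((S \<union> T) \<inter> partitions n) = card (S \<inter> partitions n) + card (T \<inter> partitions n)" for n
  proof -
    have "(S \<inter> partitions n) \<inter> (T \<inter> partitions n) = {}"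
      using assms by (auto simp: partitions_def)
    then show ?thesis by (simp add: Int_Un_distrib2 card_Un_disjoint finite_partitions)
  qed
  then show ?thesis by (simp add: fps_eq_iff part_gf_nth)
qed

text \<open>Such an \<open>f\<close> matches the members of weight \<open>n - c\<close> with the
  images of weight \<open>n\<close>; no image has weight below \<open>c\<close>.\<close>

lemma part_gf_image:
  assumes "inj_on f {\<mu> \<in> S. 0 \<notin># \<mu>}"
    and "\<And>\<mu>. \<mu> \<in> S \<Longrightarrow> 0 \<notin># f \<mu> \<longleftrightarrow> 0 \<notin># \<mu>"
    and "\<And>\<mu>. \<mu> \<in> S \<Longrightarrow> \<Sum>\<^sub># (f \<mu>) = c + \<Sum>\<^sub># \<mu>"
  shows "part_gf (f ` S) = fps_X ^ c * part_gf S"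
proof (rule fps_ext)
  fix n
  show "part_gf (f ` S) $ n = (fps_X ^ c * part_gf S) $ n"
  proof (cases "n < c")
    case True
    then have "f ` S \<inter> partitions n = {}"
      using assms(3) by (auto simp: partitions_def)
    with True show ?thesis by (simp add: part_gf_nth fps_X_power_mult_nth)
  next
    case False
    then have "f ` S \<inter> partitions n = f ` (S \<inter> partitions (n - c))"
      using assms(2,3) by (auto simp: partitions_def)
    moreover have "inj_on f (S \<inter> partitions (n - c))"
      by (rule inj_on_subset[OF assms(1)]) (auto simp: partitions_def)
    ultimately show ?thesis
      using False by (simp add: part_gf_nth fps_X_power_mult_nth card_image)
  qed
qed

lemma part_gf_add_mset: "a > 0 \<Longrightarrow> part_gf (add_mset a ` S) = fps_X ^ a * part_gf S"
  by (rule part_gf_image) (auto simp: inj_on_def)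

text \<open>Members of \<open>S\<close> and \<open>T\<close> draw on disjoint supplies of part
  sizes, so splitting by \<open>Q\<close> inverts addition of multisets. Grouping by the weight of
  the \<open>Q\<close>-half gives the Cauchy product.\<close>

lemma part_gf_mult:
  assumes "\<And>\<mu> x. \<mu> \<in> S \<Longrightarrow> x \<in># \<mu> \<Longrightarrow> Q x" "\<And>\<mu> x. \<mu> \<in> T \<Longrightarrow> x \<in># \<mu> \<Longrightarrow> \<not> Q x"
  shows "part_gf {\<mu>. filter_mset Q \<mu> \<in> S \<and> {#x \<in># \<mu>. \<not> Q x#} \<in> T} = part_gf S * part_gf T"
    (is "part_gf ?R = _")
proof (rule fps_ext)
  fix n
  let ?D = "SIGMA i:{0..n}. (S \<inter> partitions i) \<times> (T \<inter> partitions (n - i))"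
  have filt: "filter_mset Q \<mu> = \<mu>" "{#x \<in># \<mu>. \<not> Q x#} = {#}" if "\<mu> \<in> S" for \<mu>
    using assms(1) that by (auto simp: filter_mset_eq_conv)
  have filt': "filter_mset Q \<mu> = {#}" "{#x \<in># \<mu>. \<not> Q x#} = \<mu>" if "\<mu> \<in> T" for \<mu>
    using assms(2) that by (auto simp: filter_mset_eq_conv)
  have sum_split: "\<Sum>\<^sub># \<mu> = \<Sum>\<^sub># (filter_mset Q \<mu>) + \<Sum>\<^sub># {#x \<in># \<mu>. \<not> Q x#}" for \<mu> :: "nat multiset"
    by (metis multiset_partition sum_mset.union)
  have "bij_betw (\<lambda>\<mu>. (\<Sum>\<^sub># (filter_mset Q \<mu>), filter_mset Q \<mu>, {#x \<in># \<mu>. \<not> Q x#}))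
      (?R \<inter> partitions n) ?D"
  proof (rule bij_betwI[where g = "\<lambda>(_, \<mu>, \<nu>). \<mu> + \<nu>"], goal_cases)
    case 1
    show ?case
    proof
      fix \<mu> assume "\<mu> \<in> ?R \<inter> partitions n"
      then show "(\<Sum>\<^sub># (filter_mset Q \<mu>), filter_mset Q \<mu>, {#x \<in># \<mu>. \<not> Q x#}) \<in> ?D"
        using sum_split[of \<mu>] by (auto simp: partitions_def)
    qed
  next
    case 2
    show ?case by (auto simp: partitions_def filt filt')
  next
    case (3 \<mu>)
    show ?case by (simp flip: multiset_partition)
  next
    case (4 y)
    then show ?case by (auto simp: partitions_def filt filt')
  qed
  then have "card (?R \<inter> partitions n) = card ?D"
    by (rule bij_betw_same_card)
  also have "\<dots> = (\<Sum>i=0..n. card (S \<inter> partitions i) * card (T \<inter> partitions (n - i)))"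
    by (subst card_SigmaI) (auto simp: finite_partitions card_cartesian_product)
  finally show "part_gf ?R $ n = (part_gf S * part_gf T) $ n"
    by (simp add: part_gf_nth fps_mult_nth)
qed

section \<open>Truncation modulo powers of q\<close>

lemma size_le_sum_mset:
  assumes "0 \<notin># (\<mu> :: nat multiset)"
  shows "size \<mu> \<le> \<Sum>\<^sub># \<mu>"
  using assms by (induction \<mu>) auto

text \<open>The strata \<open>s \<mu> = m\<close> form an infinite sum; congruences modulo powers of \<open>q\<close> avoid limits.\<close>

lemma fps_X_power_dvd_part_gf_strata:
  assumes "\<And>\<mu>. \<mu> \<in> S \<Longrightarrow> 0 \<notin># \<mu> \<Longrightarrow> s \<mu> \<le> \<Sum>\<^sub># \<mu>"
  shows "fps_X ^ N dvd part_gf S - (\<Sum>m<N. part_gf {\<mu> \<in> S. s \<mu> = m})"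
proof -
  have "part_gf S $ n = (\<Sum>m<N. part_gf {\<mu> \<in> S. s \<mu> = m} $ n)" if "n < N" for n
  proof -
    have "S \<inter> partitions n = (\<Union>m\<in>{..<N}. {\<mu> \<in> S. s \<mu> = m} \<inter> partitions n)"
      using assms that by (force simp: partitions_def)
    then have "card (S \<inter> partitions n) = card \<dots>" by simp
    also have "\<dots> = (\<Sum>m<N. card ({\<mu> \<in> S. s \<mu> = m} \<inter> partitions n))"
      by (rule card_UN_disjoint) (auto simp: finite_partitions)
    finally show ?thesis by (simp add: part_gf_nth)
  qed
  then have nth: "(part_gf S - (\<Sum>m<N. part_gf {\<mu> \<in> S. s \<mu> = m})) $ n = 0" if "n < N" for n
    using that by (simp add: fps_sum_nth)
  have "f = fps_X ^ N * fps_shift N f" if "\<And>n. n < N \<Longrightarrow> f $ n = 0" for f :: "int fps"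
    using that by (auto simp: fps_eq_iff fps_X_power_mult_nth)
  from this[OF nth] show ?thesis by (rule dvdI)
qed

lemma fps_eq_0_if_X_power_dvd:
  fixes f :: "'a :: comm_ring_1 fps"
  assumes "\<And>N. fps_X ^ N dvd f"
  shows "f = 0"
proof (rule fps_ext)
  fix n
  from assms[of "Suc n"] obtain g where "f = fps_X ^ Suc n * g" by (elim dvdE)
  then show "f $ n = 0 $ n" by (simp add: fps_X_power_mult_nth del: power_Suc)
qed

section \<open>q-Pochhammer products and partitions with parts bounded below\<close>

definition qpoch :: "nat \<Rightarrow> int fps" where
  "qpoch n = (\<Prod>i=1..n. 1 - fps_X ^ i)"

lemma qpoch_0 [simp]: "qpoch 0 = 1"
  and qpoch_Suc [simp]: "qpoch (Suc n) = qpoch n * (1 - fps_X ^ Suc n)"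
  by (simp_all add: qpoch_def)

lemma qpoch_nonzero [simp]: "qpoch n \<noteq> 0"
proof -
  have "qpoch n $ 0 = 1" by (induction n) auto
  then show ?thesis by auto
qed

definition geq_parts :: "nat \<Rightarrow> nat multiset set" where
  "geq_parts a = {\<mu>. \<forall>x\<in>#\<mu>. a \<le> x}"

text \<open>A partition with parts at least \<open>a\<close> either avoids \<open>a\<close> or
  arises from another such partition by adding one copy of \<open>a\<close>.\<close>

lemma part_gf_geq_parts_Suc:
  assumes "a > 0"
  shows "part_gf (geq_parts (Suc a)) = (1 - fps_X ^ a) * part_gf (geq_parts a)"
proof -
  have "geq_parts a = geq_parts (Suc a) \<union> add_mset a ` geq_parts a"
  proof (intro equalityI subsetI)
    fix \<mu> assume \<mu>: "\<mu> \<in> geq_parts a"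
    show "\<mu> \<in> geq_parts (Suc a) \<union> add_mset a ` geq_parts a"
    proof (cases "a \<in># \<mu>")
      case True
      then have "\<mu> = add_mset a (\<mu> - {#a#})" by simp
      moreover have "\<mu> - {#a#} \<in> geq_parts a"
        using \<mu> by (auto simp: geq_parts_def dest: in_diffD)
      ultimately show ?thesis by blast
    next
      case False
      with \<mu> have "\<mu> \<in> geq_parts (Suc a)"
        unfolding geq_parts_def by (auto simp: Suc_le_eq order_less_le)
      then show ?thesis by blast
    qed
  qed (auto simp: geq_parts_def)
  also have "part_gf \<dots> = part_gf (geq_parts (Suc a)) + part_gf (add_mset a ` geq_parts a)"
    by (rule part_gf_Un) (auto simp: geq_parts_def)
  finally show ?thesis using assms by (simp add: part_gf_add_mset algebra_simps)
qed

lemma part_gf_geq_parts: "part_gf (geq_parts (Suc n)) = qpoch n * part_gf UNIV"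
proof (induction n)
  case 0
  show ?case by (simp, rule part_gf_cong) (auto simp: geq_parts_def Suc_le_eq intro: gr0I)
qed (simp add: part_gf_geq_parts_Suc)

text \<open>If \<open>a\<close> is a part, one copy is removed; otherwise every part is lowered by
  one, which costs the number of parts in weight. In the resulting recurrence \<open>rec\<close> the
  factor 1 - q^(m+1) extends \<open>qpoch m\<close>.\<close>

lemma part_gf_geq_parts_size:
  assumes "a > 0"
  shows "part_gf {\<mu> \<in> geq_parts a. size \<mu> = m} * qpoch m = fps_X ^ (a * m)"
proof (induction m)
  case 0
  have "{\<mu> \<in> geq_parts a. size \<mu> = 0} = {{#}}" by (auto simp: geq_parts_def)
  then show ?case by simp
next
  case (Suc m)
  let ?G = "\<lambda>a m. {\<mu> \<in> geq_parts a. size \<mu> = m}"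
  have split: "?G a (Suc m) = image_mset Suc ` ?G a (Suc m) \<union> add_mset a ` ?G a m"
  proof (intro equalityI subsetI)
    fix \<mu> assume \<mu>: "\<mu> \<in> ?G a (Suc m)"
    show "\<mu> \<in> image_mset Suc ` ?G a (Suc m) \<union> add_mset a ` ?G a m"
    proof (cases "a \<in># \<mu>")
      case True
      then have "\<mu> = add_mset a (\<mu> - {#a#})" by simp
      moreover have "\<mu> - {#a#} \<in> ?G a m"
        using \<mu> True by (auto simp: geq_parts_def size_Diff_singleton dest: in_diffD)
      ultimately show ?thesis by blast
    next
      case False
      then have gt: "a < x" if "x \<in># \<mu>" for x
        using \<mu> that by (auto simp: geq_parts_def order_less_le)
      then have "image_mset (Suc \<circ> (\<lambda>x. x - 1)) \<mu> = image_mset (\<lambda>x. x) \<mu>"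
        by (intro image_mset_cong) (force simp: o_def)
      then have "\<mu> = image_mset Suc (image_mset (\<lambda>x. x - 1) \<mu>)"
        by (simp add: multiset.map_comp)
      moreover have "image_mset (\<lambda>x. x - 1) \<mu> \<in> ?G a (Suc m)"
        using \<mu> gt by (force simp: geq_parts_def)
      ultimately show ?thesis by blast
    qed
  qed (auto simp: geq_parts_def le_Suc_eq)
  have "part_gf (?G a (Suc m)) =
      part_gf (image_mset Suc ` ?G a (Suc m)) + part_gf (add_mset a ` ?G a m)"
  proof (subst split, rule part_gf_Un)
    fix \<mu> assume "\<mu> \<in> image_mset Suc ` ?G a (Suc m)" "\<mu> \<in> add_mset a ` ?G a m"
    from this(2) have "a \<in># \<mu>" by auto
    moreover from \<open>\<mu> \<in> image_mset Suc ` ?G a (Suc m)\<close> have "\<forall>x\<in>#\<mu>. a < x"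
      by (auto simp: geq_parts_def less_Suc_eq_le)
    ultimately show False by blast
  qed
  also have "part_gf (image_mset Suc ` ?G a (Suc m)) = fps_X ^ Suc m * part_gf (?G a (Suc m))"
  proof (rule part_gf_image)
    show "inj_on (image_mset Suc) {\<mu> \<in> ?G a (Suc m). 0 \<notin># \<mu>}"
      by (rule inj_on_inverseI[where g = "image_mset (\<lambda>x. x - 1)"])
        (simp add: multiset.map_comp o_def)
    have "\<Sum>\<^sub># (image_mset Suc \<mu>) = size \<mu> + \<Sum>\<^sub># \<mu>" for \<mu>
      by (induction \<mu>) auto
    then show "\<Sum>\<^sub># (image_mset Suc \<mu>) = Suc m + \<Sum>\<^sub># \<mu>" if "\<mu> \<in> ?G a (Suc m)" for \<mu>
      using that by simp
  qed (use assms in \<open>auto simp: geq_parts_def\<close>)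
  finally have rec: "part_gf (?G a (Suc m)) * (1 - fps_X ^ Suc m) = fps_X ^ a * part_gf (?G a m)"
    using assms by (simp add: part_gf_add_mset algebra_simps)
  have "part_gf (?G a (Suc m)) * qpoch (Suc m) =
      part_gf (?G a (Suc m)) * (1 - fps_X ^ Suc m) * qpoch m"
    by (simp only: qpoch_Suc ac_simps)
  also have "\<dots> = fps_X ^ a * (part_gf (?G a m) * qpoch m)"
    by (simp only: rec mult.assoc)
  finally show ?case by (simp add: Suc.IH power_add)
qed

section \<open>The parts below the gap: Gaussian binomial coefficients\<close>

text \<open>
  The parts below the gap \<open>K + 1\<close> when there are \<open>K + 1 + d\<close> parts above it. The generating function
  is \<open>q\<^bsup>K(K+1)/2\<^esup>\<close> times the Gaussian binomial coefficient \<open>[K+d, K]\<^sub>q\<close>.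
\<close>

definition full_parts :: "nat \<Rightarrow> nat \<Rightarrow> nat multiset set" where
  "full_parts K d = {\<nu>. set_mset \<nu> = {1..K} \<and> size \<nu> \<le> K + d}"

lemma card_set_mset_le_size: "card (set_mset \<nu>) \<le> size \<nu>"
  by (induction \<nu>) (simp_all add: card_insert_le_m1)

text \<open>One copy of \<open>Suc K\<close> is removed. If another remains, the surplus
  \<open>d\<close> drops by one; if not, the parts are exactly those up to \<open>K\<close>. For
  \<open>d = 0\<close> the first case is impossible, since \<open>Suc K\<close> distinct values need
  as many parts.\<close>

lemma full_parts_rec:
  "full_parts (Suc K) d =
     add_mset (Suc K) ` ((if d = 0 then {} else full_parts (Suc K) (d - 1)) \<union> full_parts K d)"
    (is "_ = add_mset _ ` ?R")
proof (intro equalityI subsetI)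
  fix \<mu> assume \<mu>: "\<mu> \<in> full_parts (Suc K) d"
  then have in\<mu>: "Suc K \<in># \<mu>" by (simp add: full_parts_def)
  define \<nu> where "\<nu> = \<mu> - {#Suc K#}"
  have \<mu>_eq: "\<mu> = add_mset (Suc K) \<nu>" using in\<mu> by (simp add: \<nu>_def)
  have size: "size \<nu> \<le> K + d" using \<mu> by (simp add: \<mu>_eq full_parts_def)
  have ins: "insert (Suc K) (set_mset \<nu>) = {1..Suc K}" using \<mu> by (simp add: \<mu>_eq full_parts_def)
  have "\<nu> \<in> ?R"
  proof (cases "Suc K \<in># \<nu>")
    case True
    with ins have set: "set_mset \<nu> = {1..Suc K}" by (simp add: insert_absorb)
    then have "Suc K \<le> size \<nu>" using card_set_mset_le_size[of \<nu>] by simp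
    with size have "d \<noteq> 0" by auto
    moreover have "\<nu> \<in> full_parts (Suc K) (d - 1)"
      using size set \<open>d \<noteq> 0\<close> unfolding full_parts_def by simp
    ultimately show ?thesis by simp
  next
    case False
    then have "set_mset \<nu> = insert (Suc K) (set_mset \<nu>) - {Suc K}" by simp
    also have "\<dots> = {1..K}" unfolding ins by auto
    finally have "set_mset \<nu> = {1..K}" .
    with size have "\<nu> \<in> full_parts K d" unfolding full_parts_def by simp
    then show ?thesis by simp
  qed
  with \<mu>_eq show "\<mu> \<in> add_mset (Suc K) ` ?R" by blast
next
  fix \<mu> assume "\<mu> \<in> add_mset (Suc K) ` ?R"
  then obtain \<nu> where \<mu>: "\<mu> = add_mset (Suc K) \<nu>" and "\<nu> \<in> ?R" by blast
  from this(2) consider "d \<noteq> 0" "\<nu> \<in> full_parts (Suc K) (d - 1)" | "\<nu> \<in> full_parts K d"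
    by (cases "d = 0") auto
  then have "(set_mset \<nu> = {1..K} \<or> set_mset \<nu> = {1..Suc K}) \<and> size \<nu> \<le> K + d"
    by cases (simp_all add: full_parts_def)
  then have "set_mset \<nu> = {1..K} \<or> set_mset \<nu> = {1..Suc K}" and size: "size \<nu> \<le> K + d"
    by blast+
  from this(1) have "set_mset \<mu> = {1..Suc K}"
    unfolding \<mu> set_mset_add_mset_insert by (elim disjE ssubst) auto
  with size show "\<mu> \<in> full_parts (Suc K) d" by (simp add: full_parts_def \<mu>)
qed

lemma part_gf_full_parts_rec:
  "part_gf (full_parts (Suc K) d) =
     fps_X ^ Suc K * ((if d = 0 then 0 else part_gf (full_parts (Suc K) (d - 1)))
       + part_gf (full_parts K d))"
proof -
  have "set_mset \<nu> \<noteq> {1..K}" if "set_mset \<nu> = {1..Suc K}" for \<nu>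
    using that by auto
  then show ?thesis
    by (subst full_parts_rec, subst part_gf_add_mset, simp, subst part_gf_Un)
      (auto simp: full_parts_def split: if_splits)
qed

text \<open>This is the q-Pascal rule in product form. The inner step rests on q^(K+1) (1 - q^(d+1))
  + (1 - q^(K+1)) = 1 - q^(K+d+2).\<close>

lemma part_gf_full_parts:
  "part_gf (full_parts K d) * qpoch K * qpoch d = fps_X ^ (\<Sum>i\<le>K. i) * qpoch (K + d)"
proof (induction K arbitrary: d)
  case 0
  have "full_parts 0 d = {{#}}" by (auto simp: full_parts_def)
  then show ?case by simp
next
  case (Suc K)
  note IHK = Suc.IH
  show ?case
  proof (induction d)
    case 0
    show ?case
      using IHK[of 0] by (subst part_gf_full_parts_rec) (simp add: power_add ac_simps)
  next
    case (Suc d)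
    let ?A = "\<lambda>K d. part_gf (full_parts K d)"
    have "?A (Suc K) (Suc d) * qpoch (Suc K) * qpoch (Suc d) =
        fps_X ^ Suc K * ((?A (Suc K) d * qpoch (Suc K) * qpoch d) * (1 - fps_X ^ Suc d)
          + (?A K (Suc d) * qpoch K * qpoch (Suc d)) * (1 - fps_X ^ Suc K))"
      by (subst part_gf_full_parts_rec)
        (simp only: qpoch_Suc if_False diff_Suc_1 nat.distinct, simp only: algebra_simps)
    also have "\<dots> = fps_X ^ Suc K * ((fps_X ^ (\<Sum>i\<le>Suc K. i) * qpoch (Suc K + d)) * (1 - fps_X ^ Suc d)
          + (fps_X ^ (\<Sum>i\<le>K. i) * qpoch (Suc K + d)) * (1 - fps_X ^ Suc K))"
      by (simp only: Suc.IH IHK add_Suc add_Suc_right)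
    also have "\<dots> = fps_X ^ (\<Sum>i\<le>Suc K. i) * qpoch (Suc K + d) * (1 - fps_X ^ (Suc K + Suc d))"
      by (simp add: power_add algebra_simps)
    finally show ?case by (simp only: qpoch_Suc add_Suc add_Suc_right mult.assoc)
  qed
qed

section \<open>Partitions counted by M_k, sorted by the number of parts above the gap\<close>

definition M_set :: "nat \<Rightarrow> nat multiset set" where
  "M_set k = {\<mu>. k = (LEAST i. 0 < i \<and> i \<notin># \<mu>) \<and>
     size {#i \<in># \<mu>. i > k#} > size {#i \<in># \<mu>. i < k#}}"

lemma part_gf_M_set_nth: "part_gf (M_set k) $ n = int (M k n)"
proof -
  have "M_set k \<inter> partitions n = {\<mu> \<in> partitions n. k = (LEAST i. 0 < i \<and> i \<notin># \<mu>) \<and>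
      size {#i \<in># \<mu>. i > k#} > size {#i \<in># \<mu>. i < k#}}"
    unfolding M_set_def by blast
  then show ?thesis by (simp only: part_gf_nth M_def)
qed

lemma Least_missing_eq_Suc_iff:
  "Suc K = (LEAST i. 0 < i \<and> i \<notin># \<mu>) \<longleftrightarrow> Suc K \<notin># \<mu> \<and> {1..K} \<subseteq> set_mset \<mu>"
proof
  assume K: "Suc K = (LEAST i. 0 < i \<and> i \<notin># \<mu>)"
  \<comment> \<open>A number beyond all parts shows that some positive integer is missing, so
    \<open>LEAST\<close> is attained.\<close>
  obtain j where "j > Max (insert 0 (set_mset \<mu>))" by blast
  then have "0 < j \<and> j \<notin># \<mu>" by (auto simp: gr0_conv_Suc)
  then have "Suc K \<notin># \<mu>" unfolding K by (rule LeastI2) simp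
  moreover have "i \<in># \<mu>" if "i \<in> {1..K}" for i
    using not_less_Least[of i "\<lambda>i. 0 < i \<and> i \<notin># \<mu>"] that unfolding K[symmetric] by auto
  ultimately show "Suc K \<notin># \<mu> \<and> {1..K} \<subseteq> set_mset \<mu>" by blast
next
  assume *: "Suc K \<notin># \<mu> \<and> {1..K} \<subseteq> set_mset \<mu>"
  have "Suc K \<le> i" if "0 < i \<and> i \<notin># \<mu>" for i
    using * that by (auto simp: not_less_eq_eq[symmetric] subset_iff Suc_le_eq)
  with * show "Suc K = (LEAST i. 0 < i \<and> i \<notin># \<mu>)"
    by (intro Least_equality[symmetric]) auto
qed

definition M_stratum :: "nat \<Rightarrow> nat \<Rightarrow> nat multiset set" where
  "M_stratum k m = {\<mu> \<in> M_set k. size {#i \<in># \<mu>. i > k#} = m}"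

text \<open>The gap itself is absent, so the parts not below it lie above it. Membership thus
  separates into conditions on the low and on the high parts, as \<open>part_gf_mult\<close>
  requires.\<close>

lemma M_stratum_iff:
  assumes "0 \<notin># \<mu>"
  shows "\<mu> \<in> M_stratum (Suc K) m \<longleftrightarrow>
    set_mset {#x \<in># \<mu>. x < Suc K#} = {1..K} \<and> size {#x \<in># \<mu>. x < Suc K#} < m \<and>
    {#x \<in># \<mu>. \<not> x < Suc K#} \<in> {\<nu> \<in> geq_parts (Suc (Suc K)). size \<nu> = m}"
proof -
  have "Suc K \<notin># \<mu> \<and> {1..K} \<subseteq> set_mset \<mu> \<longleftrightarrow>
      set_mset {#x \<in># \<mu>. x < Suc K#} = {1..K} \<and> {#x \<in># \<mu>. \<not> x < Suc K#} \<in> geq_parts (Suc (Suc K))"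
  proof -
    have "Suc K \<notin># \<mu> \<longleftrightarrow> {#x \<in># \<mu>. \<not> x < Suc K#} \<in> geq_parts (Suc (Suc K))"
      unfolding geq_parts_def by (auto simp: not_less) (metis le_antisym not_less_eq_eq)
    moreover have "{1..K} \<subseteq> set_mset \<mu> \<longleftrightarrow> set_mset {#x \<in># \<mu>. x < Suc K#} = {1..K}"
    proof -
      have "set_mset {#x \<in># \<mu>. x < Suc K#} = set_mset \<mu> \<inter> {1..K}"
        using assms by (auto simp: Suc_le_eq less_Suc_eq_le intro: gr0I)
      then show ?thesis by blast
    qed
    ultimately show ?thesis by blast
  qed
  moreover have "{#x \<in># \<mu>. \<not> x < Suc K#} = {#x \<in># \<mu>. x > Suc K#}" if "Suc K \<notin># \<mu>"
    using that by (intro filter_mset_cong) (auto simp: not_less le_less)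
  ultimately show ?thesis
    unfolding M_stratum_def M_set_def mem_Collect_eq Least_missing_eq_Suc_iff by auto
qed

lemma part_gf_M_stratum:
  "part_gf (M_stratum (Suc K) (Suc (K + d))) =
     part_gf (full_parts K d) * part_gf {\<nu> \<in> geq_parts (Suc (Suc K)). size \<nu> = Suc (K + d)}"
proof -
  have "part_gf (M_stratum (Suc K) (Suc (K + d))) =
      part_gf {\<mu>. {#x \<in># \<mu>. x < Suc K#} \<in> full_parts K d \<and>
        {#x \<in># \<mu>. \<not> x < Suc K#} \<in> {\<nu> \<in> geq_parts (Suc (Suc K)). size \<nu> = Suc (K + d)}}"
    by (rule part_gf_cong) (simp add: M_stratum_iff full_parts_def less_Suc_eq_le)
  also have "\<dots> = part_gf (full_parts K d) *
      part_gf {\<nu> \<in> geq_parts (Suc (Suc K)). size \<nu> = Suc (K + d)}"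
    by (rule part_gf_mult) (auto simp: full_parts_def geq_parts_def)
  finally show ?thesis .
qed

text \<open>Each of 1, ..., \<open>K\<close> occurs below the gap, so more than \<open>K\<close>
  parts are needed above it.\<close>

lemma part_gf_M_stratum_eq_0:
  assumes "m \<le> K"
  shows "part_gf (M_stratum (Suc K) m) = 0"
proof -
  have "part_gf (M_stratum (Suc K) m) = part_gf {}"
  proof (rule part_gf_cong)
    fix \<mu> :: "nat multiset" assume "0 \<notin># \<mu>"
    have "\<mu> \<notin> M_stratum (Suc K) m"
    proof
      assume "\<mu> \<in> M_stratum (Suc K) m"
      then have *: "set_mset {#x \<in># \<mu>. x < Suc K#} = {1..K}" "size {#x \<in># \<mu>. x < Suc K#} < m"
        unfolding M_stratum_iff[OF \<open>0 \<notin># \<mu>\<close>] by blast+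
      have "K \<le> size {#x \<in># \<mu>. x < Suc K#}"
        using card_set_mset_le_size[of "{#x \<in># \<mu>. x < Suc K#}"] unfolding *(1) by simp
      with *(2) assms show False by linarith
    qed
    then show "\<mu> \<in> M_stratum (Suc K) m \<longleftrightarrow> \<mu> \<in> {}" by blast
  qed
  then show ?thesis by simp
qed

section \<open>The recurrence for M_k + M_(k+1)\<close>

text \<open>Here k = \<open>Suc K\<close> and m = k + \<open>d\<close>. After cancelling 1 - q^m,
  the factor 1 + q^m - q^k is written as (1 - q^k) + q^k q^d, so that its summands match partitions
  into \<open>d\<close> parts bounded below by k + 1 and by k + 2.\<close>

lemma M_stratum_step:
  "(part_gf (M_stratum (Suc K) (Suc (K + d))) + part_gf (M_stratum (Suc (Suc K)) (Suc (K + d))))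
       * qpoch (Suc K) =
   fps_X ^ ((\<Sum>i\<le>K. i) + (K + 2) * Suc K) *
     ((1 - fps_X ^ Suc K) * part_gf {\<nu> \<in> geq_parts (Suc (Suc K)). size \<nu> = d}
       + fps_X ^ Suc K * part_gf {\<nu> \<in> geq_parts (Suc (Suc (Suc K))). size \<nu> = d})"
    (is "(?S + ?S') * _ = fps_X ^ ?e * (_ * ?G + _ * ?G')")
proof -
  define m where "m = Suc (K + d)"
  define c where "c = (\<Sum>i\<le>K. i)"
  let ?Q = "qpoch (K + d)"
  have "?S * qpoch (Suc K) * qpoch d * qpoch m =
      (part_gf (full_parts K d) * qpoch K * qpoch d) * (1 - fps_X ^ Suc K) *
      (part_gf {\<nu> \<in> geq_parts (Suc (Suc K)). size \<nu> = m} * qpoch m)"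
    unfolding part_gf_M_stratum m_def qpoch_Suc by (simp only: ac_simps)
  also have "\<dots> = fps_X ^ c * ?Q * (1 - fps_X ^ Suc K) * fps_X ^ (Suc (Suc K) * m)"
    by (simp only: part_gf_full_parts part_gf_geq_parts_size[OF zero_less_Suc] c_def)
  finally have S: "?S * qpoch (Suc K) * qpoch d * qpoch m = \<dots>" .
  have S': "?S' * qpoch (Suc K) * qpoch d * qpoch m =
      fps_X ^ (c + Suc K) * ?Q * (1 - fps_X ^ d) * fps_X ^ (Suc (Suc (Suc K)) * m)"
  proof (cases d)
    \<comment> \<open>Too few parts lie above the gap \<open>Suc (Suc K)\<close>, and the factor 1 -
      q^d on the right vanishes as well.\<close>
    case 0
    then show ?thesis by (simp add: part_gf_M_stratum_eq_0)
  next
    case (Suc d')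
    have m: "m = Suc (Suc K + d')" by (simp add: m_def Suc)
    have "?S' * qpoch (Suc K) * qpoch d * qpoch m =
        (part_gf (full_parts (Suc K) d') * qpoch (Suc K) * qpoch d') * (1 - fps_X ^ d) *
        (part_gf {\<nu> \<in> geq_parts (Suc (Suc (Suc K))). size \<nu> = m} * qpoch m)"
      unfolding m_def[symmetric] unfolding m part_gf_M_stratum Suc qpoch_Suc
      by (simp only: ac_simps)
    also have "\<dots> = fps_X ^ (c + Suc K) * ?Q * (1 - fps_X ^ d) * fps_X ^ (Suc (Suc (Suc K)) * m)"
      by (simp only: part_gf_full_parts part_gf_geq_parts_size[OF zero_less_Suc])
        (simp only: c_def sum.atMost_Suc Suc add_Suc add_Suc_right)
    finally show ?thesis .
  qed
  define x :: "int fps" where "x = fps_X ^ Suc K"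
  define y :: "int fps" where "y = fps_X ^ d"
  have m_eq: "m = Suc K + d" by (simp add: m_def)
  have Xm: "fps_X ^ m = x * y" by (simp add: m_eq x_def y_def power_add)
  have exps: "fps_X ^ ((K + 2) * m) = fps_X ^ ((K + 2) * Suc K) * fps_X ^ ((K + 2) * d)"
    "fps_X ^ ((K + 3) * m) = fps_X ^ ((K + 2) * Suc K) * fps_X ^ ((K + 2) * d) * (x * y)"
    "fps_X ^ ((K + 3) * d) = fps_X ^ ((K + 2) * d) * y"
    unfolding x_def y_def power_add[symmetric]
    by (rule arg_cong[where f = "power fps_X"], simp add: m_eq algebra_simps)+
  have "(?S + ?S') * qpoch (Suc K) * (qpoch d * qpoch m) =
      ?S * qpoch (Suc K) * qpoch d * qpoch m + ?S' * qpoch (Suc K) * qpoch d * qpoch m"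
    by (simp only: algebra_simps)
  also have "\<dots> = fps_X ^ c * ?Q * (1 - x) * fps_X ^ ((K + 2) * m)
       + fps_X ^ c * x * ?Q * (1 - y) * fps_X ^ ((K + 3) * m)"
    unfolding S S' by (simp add: x_def y_def power_add eval_nat_numeral)
  \<comment> \<open>The factorisation is (1 - x) + x^2 y (1 - y) = (1 - x y) (1 - x + x y).\<close>
  also have "\<dots> = fps_X ^ c * fps_X ^ ((K + 2) * Suc K) * ?Q * (1 - x * y) *
      ((1 - x) * fps_X ^ ((K + 2) * d) + x * fps_X ^ ((K + 3) * d))"
    unfolding exps by (simp only: algebra_simps mult_1_left)
  also have "\<dots> = fps_X ^ ?e * ?Q * (1 - fps_X ^ m) *
      ((1 - x) * (?G * qpoch d) + x * (?G' * qpoch d))"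
    unfolding part_gf_geq_parts_size[OF zero_less_Suc] Xm
    by (simp add: c_def power_add eval_nat_numeral)
  \<comment> \<open>The factor 1 - q^m completes \<open>?Q\<close> to \<open>qpoch m\<close>, so
    that \<open>qpoch d * qpoch m\<close> can be cancelled.\<close>
  also have "\<dots> = fps_X ^ ?e * ((1 - x) * ?G + x * ?G') * (qpoch d * qpoch m)"
    unfolding m_def qpoch_Suc by (simp only: algebra_simps)
  finally show ?thesis by (simp add: x_def del: qpoch_Suc)
qed

text \<open>Summing \<open>M_stratum_step\<close> over \<open>d\<close> drops the restriction to
  \<open>d\<close> parts, and \<open>geq_parts\<close> has a \<open>qpoch\<close> multiple of P as
  its series. With k = \<open>Suc K\<close> the bracket becomes (1 - q^k) + q^k (1 - q^(k+1)) = 1 -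
  q^(2k+1).\<close>

lemma part_gf_M_set_add_Suc:
  "part_gf (M_set (Suc K)) + part_gf (M_set (Suc (Suc K))) =
     fps_X ^ ((\<Sum>i\<le>K. i) + (K + 2) * Suc K) * (1 - fps_X ^ (2 * K + 3)) * part_gf UNIV"
proof -
  let ?M = "\<lambda>k. part_gf (M_set k)" and ?MS = "\<lambda>k m. part_gf (M_stratum k m)"
  let ?G = "\<lambda>a. part_gf (geq_parts a)" and ?GS = "\<lambda>a m. part_gf {\<mu> \<in> geq_parts a. size \<mu> = m}"
  let ?e = "(\<Sum>i\<le>K. i) + (K + 2) * Suc K"
  let ?F = "\<lambda>u v. fps_X ^ ?e * ((1 - fps_X ^ Suc K) * u + fps_X ^ Suc K * v)"
  \<comment> \<open>The index is m = K + 1 + d. The skipped strata m \<le> K contribute nothing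
    whenever \<open>K \<le> k\<close>, so one range serves both gaps.\<close>
  have strata: "fps_X ^ N dvd ?M (Suc k) - (\<Sum>d<N. ?MS (Suc k) (Suc (K + d)))" if "K \<le> k" for N k
  proof -
    have "fps_X ^ (Suc K + N) dvd ?M (Suc k) - (\<Sum>m<Suc K + N. ?MS (Suc k) m)"
      unfolding M_stratum_def
    proof (rule fps_X_power_dvd_part_gf_strata)
      fix \<mu> :: "nat multiset" assume "0 \<notin># \<mu>"
      have "size {#i \<in># \<mu>. Suc k < i#} \<le> size \<mu>" by (simp add: size_mset_mono)
      also have "\<dots> \<le> \<Sum>\<^sub># \<mu>" using \<open>0 \<notin># \<mu>\<close> by (rule size_le_sum_mset)
      finally show "size {#i \<in># \<mu>. Suc k < i#} \<le> \<Sum>\<^sub># \<mu>" .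
    qed
    moreover have "(\<Sum>m<Suc K + N. ?MS (Suc k) m) =
        (\<Sum>m<Suc K. ?MS (Suc k) m) + (\<Sum>d<N. ?MS (Suc k) (Suc K + d))"
      by (induction N) (simp_all add: add.assoc)
    moreover have "(\<Sum>m<Suc K. ?MS (Suc k) m) = 0"
      using that by (intro sum.neutral) (auto simp: part_gf_M_stratum_eq_0)
    ultimately show ?thesis
      by (simp add: power_add) (metis dvd_mult_left mult.commute)
  qed
  have strata_G: "fps_X ^ N dvd ?G a - (\<Sum>d<N. ?GS a d)" for N a
    by (rule fps_X_power_dvd_part_gf_strata) (rule size_le_sum_mset)
  have "(?M (Suc K) + ?M (Suc (Suc K))) * qpoch (Suc K) - ?F (?G (Suc (Suc K))) (?G (Suc (Suc (Suc K)))) = 0"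
  proof (rule fps_eq_0_if_X_power_dvd)
    fix N
    \<comment> \<open>Both sides are linear in the four series and agree on partial sums, so their
      difference is the same expression in the truncation errors, each divisible by q^N.\<close>
    let ?D = "\<lambda>k. ?M (Suc k) - (\<Sum>d<N. ?MS (Suc k) (Suc (K + d)))"
    let ?DG = "\<lambda>a. ?G a - (\<Sum>d<N. ?GS a d)"
    have "((\<Sum>d<N. ?MS (Suc K) (Suc (K + d))) + (\<Sum>d<N. ?MS (Suc (Suc K)) (Suc (K + d)))) * qpoch (Suc K)
        = (\<Sum>d<N. ?F (?GS (Suc (Suc K)) d) (?GS (Suc (Suc (Suc K))) d))"
      by (simp only: sum.distrib[symmetric] sum_distrib_right M_stratum_step)
    also have "\<dots> = ?F (\<Sum>d<N. ?GS (Suc (Suc K)) d) (\<Sum>d<N. ?GS (Suc (Suc (Suc K))) d)"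
      by (simp only: sum_distrib_left sum.distrib[symmetric])
    finally have "(?M (Suc K) + ?M (Suc (Suc K))) * qpoch (Suc K) - ?F (?G (Suc (Suc K))) (?G (Suc (Suc (Suc K))))
        = (?D K + ?D (Suc K)) * qpoch (Suc K) - ?F (?DG (Suc (Suc K))) (?DG (Suc (Suc (Suc K))))"
      by (simp only: algebra_simps)
    moreover have "fps_X ^ N dvd \<dots>"
      by (intro dvd_diff dvd_add dvd_mult dvd_mult2 strata strata_G) simp_all
    ultimately show "fps_X ^ N dvd
        (?M (Suc K) + ?M (Suc (Suc K))) * qpoch (Suc K) - ?F (?G (Suc (Suc K))) (?G (Suc (Suc (Suc K))))"
      by (simp only:)
  qed
  then have "(?M (Suc K) + ?M (Suc (Suc K))) * qpoch (Suc K) =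
      ?F (qpoch (Suc K) * part_gf UNIV) (qpoch (Suc (Suc K)) * part_gf UNIV)"
    by (simp only: part_gf_geq_parts right_minus_eq)
  also have "\<dots> = (fps_X ^ ?e * (1 - fps_X ^ Suc K * fps_X ^ Suc (Suc K)) * part_gf UNIV) * qpoch (Suc K)"
    unfolding qpoch_Suc[of "Suc K"] by (simp only: algebra_simps mult_1_left)
  also have "fps_X ^ Suc K * fps_X ^ Suc (Suc K) = (fps_X ^ (2 * K + 3) :: int fps)"
    unfolding power_add[symmetric] by (rule arg_cong[where f = "power fps_X"]) simp
  finally show ?thesis by (simp only: mult_cancel_right qpoch_nonzero simp_thms)
qed

section \<open>The truncated pentagonal number theorem\<close>

text \<open>No part lies below the gap 1, so the size condition only asks for some part. A partition
  without the part 1 is therefore empty or counted by M_1.\<close>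

lemma part_gf_M_set_1: "1 + part_gf (M_set (Suc 0)) = (1 - fps_X) * part_gf UNIV"
proof -
  have "(1 - fps_X) * part_gf UNIV = part_gf (geq_parts (Suc (Suc 0)))"
    by (simp add: part_gf_geq_parts)
  also have "\<dots> = part_gf ({{#}} \<union> M_set (Suc 0))"
  proof (rule part_gf_cong)
    fix \<mu> :: "nat multiset" assume pos: "0 \<notin># \<mu>"
    have "\<mu> \<in> M_set (Suc 0) \<longleftrightarrow> Suc 0 \<notin># \<mu> \<and> \<mu> \<noteq> {#}"
    proof -
      have empty: "{#i \<in># \<mu>. i < Suc 0#} = {#}" using pos by (auto intro: gr0I)
      have "{#i \<in># \<mu>. Suc 0 < i#} = \<mu>" if "Suc 0 \<notin># \<mu>"
        using pos that by (auto simp: filter_mset_eq_conv) (metis Suc_lessI gr0I)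
      then show ?thesis
        unfolding M_set_def mem_Collect_eq Least_missing_eq_Suc_iff empty
        by (cases "Suc 0 \<in># \<mu>") (simp_all add: nonempty_has_size)
    qed
    moreover have "\<mu> \<in> geq_parts (Suc (Suc 0)) \<longleftrightarrow> Suc 0 \<notin># \<mu>"
      using pos unfolding geq_parts_def by (auto simp: Suc_le_eq) (metis Suc_lessI gr0I)
    ultimately show "\<mu> \<in> geq_parts (Suc (Suc 0)) \<longleftrightarrow> \<mu> \<in> {{#}} \<union> M_set (Suc 0)"
      by auto
  qed
  also have "\<dots> = 1 + part_gf (M_set (Suc 0))"
    by (subst part_gf_Un) (auto simp: M_set_def)
  finally show ?thesis by simp
qed

text \<open>The numerator is even and nonnegative for all integers \<open>j\<close>, so neither \<open>div\<close> nor \<open>nat\<close> truncates.\<close>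

definition pent :: "int \<Rightarrow> nat" where
  "pent j = nat (j * (3 * j - 1) div 2)"

lemma pent_double: "2 * int (pent j) = j * (3 * j - 1)"
proof -
  have "even (j * (3 * j - 1))" by simp
  moreover have "0 \<le> j * (3 * j - 1)"
    by (cases "j \<le> 0") (auto intro: mult_nonpos_nonpos)
  ultimately show ?thesis by (simp add: pent_def)
qed

text \<open>The new indices -(K+1) and K+2 have opposite signs and exponents differing by 2K+3.
  Times P they give (-1)^(K+1) (M_(K+1) + M_(K+2)), which exchanges the old remainder for the new
  one.\<close>

lemma truncated_pentagonal:
  "part_gf UNIV * (\<Sum>j = -int K..int K + 1. (-1) ^ nat \<bar>j\<bar> * fps_X ^ pent j) =
     1 + (-1) ^ K * part_gf (M_set (Suc K))"
proof (induction K)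
  case 0
  have "{0..1} = {0, 1 :: int}" by auto
  then show ?case by (simp add: part_gf_M_set_1 pent_def mult.commute)
next
  case (Suc K)
  let ?f = "\<lambda>j. (-1) ^ nat \<bar>j\<bar> * fps_X ^ pent j :: int fps"
  let ?e = "(\<Sum>i\<le>K. i) + (K + 2) * Suc K"
  \<comment> \<open>The equation is doubled because \<open>pent_double\<close> determines
    \<open>pent j\<close> through its double.\<close>
  have e: "2 * ?e = Suc K * (3 * K + 4)"
    using gauss_sum_nat[of K] by (simp add: atLeast0AtMost algebra_simps)
  have pent_eqI: "pent j = i" if "j * (3 * j - 1) = 2 * int i" for i j
    using that pent_double[of j] by simp
  have pent1: "pent (- int (Suc K)) = ?e"
    by (rule pent_eqI) (use arg_cong[OF e, of int] in \<open>simp add: algebra_simps\<close>)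
  have pent2: "pent (int (Suc K) + 1) = ?e + (2 * K + 3)"
    by (rule pent_eqI) (use arg_cong[OF e, of int] in \<open>simp add: algebra_simps\<close>)
  have "{- int (Suc K)..int (Suc K) + 1} = insert (- int (Suc K)) (insert (int (Suc K) + 1) {- int K..int K + 1})"
    by auto
  then have "(\<Sum>j = - int (Suc K)..int (Suc K) + 1. ?f j) =
      ?f (- int (Suc K)) + (?f (int (Suc K) + 1) + (\<Sum>j = - int K..int K + 1. ?f j))"
    by simp
  also have "?f (- int (Suc K)) = (-1) ^ Suc K * fps_X ^ ?e"
  proof -
    have "nat \<bar>- int (Suc K)\<bar> = Suc K" by simp
    then show ?thesis by (simp only: pent1)
  qed
  also have "?f (int (Suc K) + 1) = - ((-1) ^ Suc K * fps_X ^ ?e * fps_X ^ (2 * K + 3))"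
  proof -
    have "nat \<bar>int (Suc K) + 1\<bar> = Suc (Suc K)" by simp
    then show ?thesis by (simp only: pent2 power_add[of _ ?e]) simp
  qed
  finally have "part_gf UNIV * (\<Sum>j = - int (Suc K)..int (Suc K) + 1. ?f j) =
      (-1) ^ Suc K * (fps_X ^ ?e * (1 - fps_X ^ (2 * K + 3)) * part_gf UNIV)
      + part_gf UNIV * (\<Sum>j = - int K..int K + 1. ?f j)"
    by (simp only:) (simp only: algebra_simps mult_1_left mult_minus_right add_uminus_conv_diff diff_add_cancel)
  also have "\<dots> = 1 + (-1) ^ Suc K * part_gf (M_set (Suc (Suc K)))"
    unfolding Suc.IH part_gf_M_set_add_Suc[symmetric] by (simp add: algebra_simps)
  finally show ?case .
qed

section \<open>Substituting q^l for q, and l-regular partitions\<close>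

lemma fps_compose_X_power_nth:
  fixes f :: "'a :: comm_ring_1 fps"
  assumes "l > 0"
  shows "(f oo fps_X ^ l) $ n = (if l dvd n then f $ (n div l) else 0)"
proof -
  have "(f oo fps_X ^ l) $ n = (\<Sum>i=0..n. if n = l * i then f $ i else 0)"
    by (auto simp: fps_compose_nth power_mult[symmetric] intro!: sum.cong)
  also have "\<dots> = (\<Sum>i\<in>{0..n}. if i = n div l \<and> l dvd n then f $ i else 0)"
    using assms by (intro sum.cong) auto
  also have "\<dots> = (if l dvd n then f $ (n div l) else 0)"
    by auto
  finally show ?thesis .
qed

text \<open>Scaling all parts by \<open>l\<close> is a bijection that scales the weight by
  \<open>l\<close>; weights not divisible by \<open>l\<close> do not occur.\<close>

lemma part_gf_multiples:
  assumes "l > 0"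
  shows "part_gf {\<mu>. \<forall>x\<in>#\<mu>. l dvd x} = part_gf UNIV oo fps_X ^ l"
proof (rule fps_ext)
  fix n
  let ?S = "{\<mu>. \<forall>x\<in>#\<mu>. l dvd x}"
  have "card (?S \<inter> partitions n) = (if l dvd n then card (partitions (n div l)) else 0)"
  proof (cases "l dvd n")
    case True
    then obtain m where n: "n = l * m" by (elim dvdE)
    have sum: "\<Sum>\<^sub># (image_mset ((*) l) \<mu>) = l * \<Sum>\<^sub># \<mu>" for \<mu> :: "nat multiset"
      by (induction \<mu>) (auto simp: algebra_simps)
    have inv: "image_mset (\<lambda>x. l * (x div l)) \<mu> = \<mu>" if "\<mu> \<in> ?S" for \<mu>
      using that image_mset_cong[of \<mu> "\<lambda>x. l * (x div l)" "\<lambda>x. x"] by simp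
    have "bij_betw (image_mset ((*) l)) (partitions m) (?S \<inter> partitions n)"
    proof (rule bij_betwI[where g = "image_mset (\<lambda>x. x div l)"])
      show "image_mset ((*) l) \<in> partitions m \<rightarrow> ?S \<inter> partitions n"
        using assms by (auto simp: partitions_def sum n)
      show "image_mset (\<lambda>x. x div l) \<in> ?S \<inter> partitions n \<rightarrow> partitions m"
      proof
        fix \<mu> assume \<mu>: "\<mu> \<in> ?S \<inter> partitions n"
        have "l * \<Sum>\<^sub># (image_mset (\<lambda>x. x div l) \<mu>) = l * m"
          using \<mu> inv[of \<mu>] sum[of "image_mset (\<lambda>x. x div l) \<mu>"]
          by (auto simp: multiset.map_comp o_def partitions_def n)
        moreover have "0 \<notin># image_mset (\<lambda>x. x div l) \<mu>"
          using \<mu> by (auto simp: partitions_def) (metis dvd_div_eq_0_iff)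
        ultimately show "image_mset (\<lambda>x. x div l) \<mu> \<in> partitions m"
          using assms by (simp add: partitions_def)
      qed
    qed (use assms inv in \<open>auto simp: multiset.map_comp o_def\<close>)
    with assms show ?thesis by (simp add: bij_betw_same_card n)
  next
    case False
    have "l dvd \<Sum>\<^sub># \<mu>" if "\<mu> \<in> ?S" for \<mu>
      using that by (induction \<mu>) auto
    with False have "?S \<inter> partitions n = {}" by (auto simp: partitions_def)
    with False show ?thesis by simp
  qed
  with assms show "part_gf ?S $ n = (part_gf UNIV oo fps_X ^ l) $ n"
    by (simp add: part_gf_nth fps_compose_X_power_nth)
qed

text \<open>Every partition splits uniquely into its multiples of \<open>l\<close> and its other
  parts.\<close>

lemma part_gf_regular_mult:
  assumes "l > 0"
  shows "part_gf (Collect (regular l)) * (part_gf UNIV oo fps_X ^ l) = part_gf UNIV"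
proof -
  have "part_gf (Collect (regular l)) * part_gf {\<mu>. \<forall>x\<in>#\<mu>. l dvd x} =
      part_gf {\<mu>. {#x \<in># \<mu>. \<not> l dvd x#} \<in> Collect (regular l) \<and>
        {#x \<in># \<mu>. \<not> \<not> l dvd x#} \<in> {\<mu>. \<forall>x\<in>#\<mu>. l dvd x}}"
    by (rule part_gf_mult[symmetric]) (auto simp: regular_def)
  also have "\<dots> = part_gf UNIV"
    by (rule part_gf_cong) (auto simp: regular_def)
  finally show ?thesis using assms by (simp add: part_gf_multiples)
qed

theorem theorem1p8:
  fixes n k :: nat
  assumes "k > 0"
  shows "(-1) ^ k * (int (b 6 n) -
           (\<Sum>j = -(int k - 1)..int k. (-1) ^ nat \<bar>j\<bar> * int (p (int n - 3 * j * (3 * j - 1)))))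
         = (\<Sum>j = 0..n div 6. int (b 6 (n - 6 * j)) * int (M k j))"
proof -
  obtain K where k: "k = Suc K" using assms by (cases k) auto
  let ?B = "part_gf (Collect (regular 6))" and ?P = "part_gf UNIV"
  let ?M = "part_gf (M_set k)" and ?X = "fps_X ^ 6 :: int fps"
  have X0: "?X $ 0 = 0" by simp
  have J: "{- int K..int K + 1} = {-(int k - 1)..int k}" by (simp add: k)
  \<comment> \<open>Since q^6 has zero constant term, the substitution respects sums, products and
    powers.\<close>
  have "(\<Sum>j = -(int k - 1)..int k. (-1) ^ nat \<bar>j\<bar> * fps_X ^ pent j) oo ?X =
      (\<Sum>j = -(int k - 1)..int k. (-1) ^ nat \<bar>j\<bar> * ?X ^ pent j)"
    by (simp add: fps_compose_sum_distrib fps_compose_mult_distrib[OF X0]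
        fps_compose_power[OF X0, symmetric] fps_compose_uminus)
  then have "?B * (?P oo ?X) * (\<Sum>j = -(int k - 1)..int k. (-1) ^ nat \<bar>j\<bar> * ?X ^ pent j) =
      ?B * ((?P * (\<Sum>j = -(int k - 1)..int k. (-1) ^ nat \<bar>j\<bar> * fps_X ^ pent j)) oo ?X)"
    by (simp only: fps_compose_mult_distrib[OF X0] mult.assoc)
  also have "\<dots> = ?B * (1 + (-1) ^ K * (?M oo ?X))"
    unfolding J[symmetric] truncated_pentagonal
    by (simp add: k fps_compose_add_distrib fps_compose_mult_distrib[OF X0]
        fps_compose_power[OF X0, symmetric] fps_compose_uminus)
  finally have main: "?P * (\<Sum>j = -(int k - 1)..int k. (-1) ^ nat \<bar>j\<bar> * ?X ^ pent j) =
      ?B + (-1) ^ K * (?B * (?M oo ?X))"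
    by (simp add: part_gf_regular_mult algebra_simps)
  have sign: "((-1) ^ i * f :: int fps) $ n = (-1) ^ i * f $ n" for i f
    by (cases "even i") auto
  have B_nth: "?B $ i = int (b 6 i)" for i
    by (simp add: part_gf_nth b_def Int_def conj_commute)
  have "?P * (\<Sum>j = -(int k - 1)..int k. (-1) ^ nat \<bar>j\<bar> * ?X ^ pent j) =
      (\<Sum>j = -(int k - 1)..int k. (-1) ^ nat \<bar>j\<bar> * (?X ^ pent j * ?P))"
    by (simp add: sum_distrib_left mult_ac)
  moreover have "(?X ^ pent j * ?P) $ n = int (p (int n - 3 * j * (3 * j - 1)))" for j
  proof -
    \<comment> \<open>The exponent 6 \<open>pent j\<close> is the shift in the theorem. If it
      exceeds \<open>n\<close>, the coefficient is 0, as is \<open>p\<close> at a negative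
      argument.\<close>
    have "3 * j * (3 * j - 1) = int (6 * pent j)" using pent_double[of j] by simp
    then show ?thesis
      unfolding power_mult[symmetric]
      by (auto simp: fps_X_power_mult_nth p_def part_gf_nth nat_diff_distrib simp del: of_nat_mult)
  qed
  ultimately have lhs: "(?P * (\<Sum>j = -(int k - 1)..int k. (-1) ^ nat \<bar>j\<bar> * ?X ^ pent j)) $ n =
      (\<Sum>j = -(int k - 1)..int k. (-1) ^ nat \<bar>j\<bar> * int (p (int n - 3 * j * (3 * j - 1))))"
    by (simp add: fps_sum_nth sign)
  have "(?B * (?M oo ?X)) $ n = ((?M oo ?X) * ?B) $ n" by (simp only: mult.commute)
  also have "\<dots> = (\<Sum>i=0..n. if 6 dvd i then int (M k (i div 6)) * int (b 6 (n - i)) else 0)"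
    unfolding fps_mult_nth by (intro sum.cong)
      (auto simp: fps_compose_X_power_nth part_gf_M_set_nth B_nth)
  \<comment> \<open>Only i = 6 j contributes, and i \<le> n means j \<le> n div 6.\<close>
  also have "\<dots> = (\<Sum>i\<in>(*) 6 ` {0..n div 6}. int (M k (i div 6)) * int (b 6 (n - i)))"
    by (rule sum.mono_neutral_cong_right) auto
  also have "\<dots> = (\<Sum>j = 0..n div 6. int (b 6 (n - 6 * j)) * int (M k j))"
    by (subst sum.reindex) (auto simp: inj_on_def mult.commute)
  finally have rhs: "(?B * (?M oo ?X)) $ n = \<dots>" .
  \<comment> \<open>Since k = \<open>Suc K\<close>, isolating the remainder in \<open>main\<close>
    and multiplying by (-1)^k removes its sign.\<close>
  show ?thesis
    using arg_cong[OF main, of "\<lambda>f. f $ n"] unfolding lhs fps_add_nth sign rhs B_nth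
    by (cases "even K") (simp_all add: k)
qed

end
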